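(* Consider a polygonal grid in which every cell has at most four edges. Let $(\mathbf v_c(t),p_c(t))_{c\in\mathcal C}$, $\mathbf v_c(t)\in\mathbb R^2$, $p_c(t)\in\mathbb R$, be a solution of the semi-discrete nodal-pressure method $$\frac{d}{dt}\mathbf v_c=-\frac1{|c|}\sum_{n\in\mathcal N(c)}\ell_{nc}\mathbf n_{nc}\,p_n^*,\qquad \frac{d}{dt}p_c=-\frac1{|c|}\sum_{n\in\mathcal N(c)}\ \sum_{s\in\mathcal{SE}(n,c)}|s|\,(p_c-p_n^* ),\qquad c\in\mathcal C,$$ where $$p_n^*=\frac{\sum_{s\in\mathcal{SE}(n)}|s|\,\frac{p_{\mathrm R}+p_{\mathrm L}}2-\frac12|c_n|(D\mathbf v)_n}{\sum_{s\in\mathcal{SE}(n)}|s|},\qquad (D\mathbf v)_n=-\frac1{|c_n|}\sum_{c\in\mathcal C(n)}\ell_{nc}\mathbf n_{nc}\cdot\mathbf v_c .$$ Then the discrete vorticity $$(C\mathbf v)_n := -\frac{1}{|c_n|}\sum_{c\in\mathcal C(n)} \ell_{nc}\mathbf n_{nc}\times \mathbf v_c$$ is stationary: $\frac{d}{dt}(C\mathbf v)_n=0$ for every node $n\in\mathcal N$.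
   Context: The grid is a locally finite, edge-to-edge tiling, without boundary, of $\mathbb R^2$ or of a flat torus (doubly periodic domain) by simple polygonal cells; the vertices of each cell are pairwise distinct nodes, and every edge is shared by exactly two cells. $\mathcal C$ and $\mathcal N$ are the sets of cells and nodes; $\mathcal C(n)$ is the set of cells having $n$ as a vertex; $\mathcal N(c)$ is the set of vertices of cell $c$. $|c|$ is the area of $c$. Each edge $e$ is cut at its midpoint into two subedges of length $|e|/2$, one adjacent to each endpoint. $\mathcal{SE}(n)$ is the set of subedges adjacent to node $n$, and $\mathcal{SE}(n,c)$ is the set of the two of them lying on the boundary of cell $c$; $|s|$ is the length of subedge $s$, and $\mathbf n_{s,c}$ is the unit normal to $s$ pointing out of $c$. For each subedge $s$ (with a fixed choice of unit normal), $p_{\mathrm L},p_{\mathrm R}$ are the values of $p$ in the two cells adjacent to $s$, the normal pointing from L to R. The node-normal is $\ell_{nc}\mathbf n_{nc}:=\sum_{s\in\mathcal{SE}(n,c)}|s|\,\mathbf n_{s,c}$ (with $|\mathbf n_{nc}|=1$). $c_n$ is the dual cell of node $n$: the polygonal region whose vertices are the centroids of all cells in $\mathcal C(n)$ and the midpoints of all edges containing $n$; $|c_n|>0$ is its area. For $\mathbf a,\mathbf b\in\mathbb R^2$, $\mathbf a\times\mathbf b:=a_1b_2-a_2b_1$. *)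

theory Defs
  imports "HOL-Analysis.Analysis"
begin

type_synonym point = "real^2"

text \<open>A cell is given by the list of its vertices, listed cyclically in either orientation;
  an edge is the set of its two endpoints, and \<^term>\<open>convex hull {a, b}\<close> is the segment itself.\<close>
type_synonym cell = "point list"

definition cross2 :: "point \<Rightarrow> point \<Rightarrow> real" where
  "cross2 a b = a$1 * b$2 - a$2 * b$1"

definition cell_edges :: "cell \<Rightarrow> point set set" where
  "cell_edges c = {{c ! i, c ! (Suc i mod length c)} | i. i < length c}"

definition simple_polygon :: "cell \<Rightarrow> bool" where
  "simple_polygon c \<longleftrightarrow> 3 \<le> length c \<and> distinct c \<and>
     (\<forall>e\<in>cell_edges c. \<forall>e'\<in>cell_edges c. e \<noteq> e' \<longrightarrow>
        convex hull e \<inter> convex hull e' \<subseteq> e \<inter> e')"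

definition cell_boundary :: "cell \<Rightarrow> point set" where
  "cell_boundary c = (\<Union>e\<in>cell_edges c. convex hull e)"

definition cell_region :: "cell \<Rightarrow> point set" where
  "cell_region c = cell_boundary c \<union> inside (cell_boundary c)"

definition cell_area :: "cell \<Rightarrow> real" where
  "cell_area c = measure lebesgue (cell_region c)"

definition cell_centroid :: "cell \<Rightarrow> point" where
  "cell_centroid c = (1 / cell_area c) *\<^sub>R integral (cell_region c) (\<lambda>x. x)"

definition grid_nodes :: "cell set \<Rightarrow> point set" where
  "grid_nodes C = (\<Union>c\<in>C. set c)"

definition grid_edges :: "cell set \<Rightarrow> point set set" where
  "grid_edges C = (\<Union>c\<in>C. cell_edges c)"

definition translate_cell :: "point \<Rightarrow> cell \<Rightarrow> cell" where
  "translate_cell l c = map (\<lambda>x. l + x) c"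

text \<open>The group of periods of the domain: trivial for the plane, of rank two for a flat torus.\<close>
definition period_group :: "point set \<Rightarrow> bool" where
  "period_group \<Lambda> \<longleftrightarrow> \<Lambda> = {0} \<or>
     (\<exists>a b. cross2 a b \<noteq> 0 \<and>
        \<Lambda> = {of_int i *\<^sub>R a + of_int j *\<^sub>R b | i j. True})"

text \<open>A grid on the domain \<open>\<real>\<^sup>2 / \<Lambda>\<close> is represented by its lift, a \<open>\<Lambda>\<close>-invariant tiling of
  the plane. The last two conditions transfer to the quotient that the vertices of a cell are
  distinct nodes and that the two cells sharing an edge are distinct. Because of them,
  the incidence sets (cells at a node, vertices of a cell, subedges at a node) of the lift are in
  bijection with those of the quotient.\<close>
definition polygonal_grid :: "point set \<Rightarrow> cell set \<Rightarrow> bool" where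
  "polygonal_grid \<Lambda> C \<longleftrightarrow>
     period_group \<Lambda> \<and>
     (\<forall>c\<in>C. simple_polygon c) \<and>
     (\<Union>c\<in>C. cell_region c) = UNIV \<and>
     (\<forall>c\<in>C. \<forall>c'\<in>C. c \<noteq> c' \<longrightarrow> interior (cell_region c) \<inter> interior (cell_region c') = {}) \<and>
     (\<forall>x. \<exists>r>0. finite {c \<in> C. cell_region c \<inter> ball x r \<noteq> {}}) \<and>
     (\<forall>e\<in>grid_edges C. \<forall>e'\<in>grid_edges C. e \<noteq> e' \<longrightarrow>
        convex hull e \<inter> convex hull e' \<subseteq> e \<inter> e') \<and>
     (\<forall>e\<in>grid_edges C. card {c \<in> C. e \<in> cell_edges c} = 2) \<and>
     (\<forall>l\<in>\<Lambda>. \<forall>c\<in>C. translate_cell l c \<in> C) \<and>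
     (\<forall>c\<in>C. \<forall>x\<in>set c. \<forall>y\<in>set c. x - y \<in> \<Lambda> \<longrightarrow> x = y) \<and>
     (\<forall>c\<in>C. \<forall>l\<in>\<Lambda>. l \<noteq> 0 \<longrightarrow> cell_edges c \<inter> cell_edges (translate_cell l c) = {})"

definition cells_at :: "cell set \<Rightarrow> point \<Rightarrow> cell set" where
  "cells_at C n = {c \<in> C. n \<in> set c}"

text \<open>A subedge is the pair of its endpoints: the adjacent node and the midpoint of the edge.\<close>
type_synonym subedge = "point \<times> point"

definition subedges_at :: "cell set \<Rightarrow> point \<Rightarrow> subedge set" where
  "subedges_at C n = {(n, midpoint n m) | m. {n, m} \<in> grid_edges C}"

definition subedges_of :: "point \<Rightarrow> cell \<Rightarrow> subedge set" where
  "subedges_of n c = {(n, midpoint n m) | m. {n, m} \<in> cell_edges c}"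

definition subedge_length :: "subedge \<Rightarrow> real" where
  "subedge_length s = dist (fst s) (snd s)"

definition unit_normal :: "subedge \<Rightarrow> point \<Rightarrow> bool" where
  "unit_normal s u \<longleftrightarrow> norm u = 1 \<and> u \<bullet> (snd s - fst s) = 0"

definition outward_normal :: "subedge \<Rightarrow> cell \<Rightarrow> point" where
  "outward_normal s c = (THE u. unit_normal s u \<and>
     (\<forall>x\<in>open_segment (fst s) (snd s).
        eventually (\<lambda>\<epsilon>. x + \<epsilon> *\<^sub>R u \<notin> cell_region c) (at_right 0)))"

text \<open>The product \<open>\<ell>\<^sub>n\<^sub>c \<^bold>n\<^sub>n\<^sub>c\<close>; its two factors only ever occur together.\<close>
definition node_normal :: "point \<Rightarrow> cell \<Rightarrow> point" where
  "node_normal n c = (\<Sum>s\<in>subedges_of n c. subedge_length s *\<^sub>R outward_normal s c)"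

text \<open>The chosen normal \<open>\<nu> s\<close> points from the left cell to the right cell.\<close>
definition left_cell :: "cell set \<Rightarrow> (subedge \<Rightarrow> point) \<Rightarrow> subedge \<Rightarrow> cell" where
  "left_cell C \<nu> s = (THE c. c \<in> C \<and> s \<in> subedges_of (fst s) c \<and> outward_normal s c = \<nu> s)"

definition right_cell :: "cell set \<Rightarrow> (subedge \<Rightarrow> point) \<Rightarrow> subedge \<Rightarrow> cell" where
  "right_cell C \<nu> s = (THE c. c \<in> C \<and> s \<in> subedges_of (fst s) c \<and> outward_normal s c = - \<nu> s)"

text \<open>The sides of the dual cell join, in each cell around \<open>n\<close>, the centroid of that cell to the
  midpoints of its two edges containing \<open>n\<close>.\<close>
definition dual_boundary :: "cell set \<Rightarrow> point \<Rightarrow> point set" where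
  "dual_boundary C n =
     (\<Union>c\<in>cells_at C n. \<Union>s\<in>subedges_of n c. closed_segment (cell_centroid c) (snd s))"

definition dual_cell :: "cell set \<Rightarrow> point \<Rightarrow> point set" where
  "dual_cell C n = dual_boundary C n \<union> inside (dual_boundary C n)"

definition dual_area :: "cell set \<Rightarrow> point \<Rightarrow> real" where
  "dual_area C n = measure lebesgue (dual_cell C n)"

definition discrete_div :: "cell set \<Rightarrow> (cell \<Rightarrow> point) \<Rightarrow> point \<Rightarrow> real" where
  "discrete_div C v n = - (1 / dual_area C n) * (\<Sum>c\<in>cells_at C n. node_normal n c \<bullet> v c)"

definition discrete_vorticity :: "cell set \<Rightarrow> (cell \<Rightarrow> point) \<Rightarrow> point \<Rightarrow> real" where
  "discrete_vorticity C v n =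
     - (1 / dual_area C n) * (\<Sum>c\<in>cells_at C n. cross2 (node_normal n c) (v c))"

definition nodal_pressure ::
  "cell set \<Rightarrow> (subedge \<Rightarrow> point) \<Rightarrow> (cell \<Rightarrow> point) \<Rightarrow> (cell \<Rightarrow> real) \<Rightarrow> point \<Rightarrow> real" where
  "nodal_pressure C \<nu> v p n =
     ((\<Sum>s\<in>subedges_at C n.
         subedge_length s * ((p (right_cell C \<nu> s) + p (left_cell C \<nu> s)) / 2))
       - 1 / 2 * dual_area C n * discrete_div C v n)
     / (\<Sum>s\<in>subedges_at C n. subedge_length s)"

definition nodal_pressure_solution ::
  "point set \<Rightarrow> cell set \<Rightarrow> (subedge \<Rightarrow> point) \<Rightarrow> real set \<Rightarrow>
     (real \<Rightarrow> cell \<Rightarrow> point) \<Rightarrow> (real \<Rightarrow> cell \<Rightarrow> real) \<Rightarrow> bool" where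
  "nodal_pressure_solution \<Lambda> C \<nu> T v p \<longleftrightarrow>
     (\<forall>t\<in>T. \<forall>l\<in>\<Lambda>. \<forall>c\<in>C.
        v t (translate_cell l c) = v t c \<and> p t (translate_cell l c) = p t c) \<and>
     (\<forall>t\<in>T. \<forall>c\<in>C.
        ((\<lambda>\<tau>. v \<tau> c) has_vector_derivative
           - (1 / cell_area c) *\<^sub>R
             (\<Sum>n\<in>set c. nodal_pressure C \<nu> (v t) (p t) n *\<^sub>R node_normal n c)) (at t within T) \<and>
        ((\<lambda>\<tau>. p \<tau> c) has_real_derivative
           - (1 / cell_area c) *
             (\<Sum>n\<in>set c. \<Sum>s\<in>subedges_of n c.
                subedge_length s * (p t c - nodal_pressure C \<nu> (v t) (p t) n))) (at t within T))"

end

theory Submission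
  imports Defs
begin

text \<open>
  The velocity of a cell changes by a discrete gradient of the nodal pressures, and the vorticity is a
  discrete curl of the velocity. The vorticity is conserved because this curl annihilates the gradient
  of every nodal function \<open>q\<close> (\<open>pressure_force_irrotational\<close>).

  Take the vertices of a cell in counterclockwise order. The node-normal of a vertex is half the
  vector from its predecessor to its successor, turned clockwise by a right angle
  (\<open>node_normal_eq\<close>). In a triangle or a quadrilateral, the cross product of the node-normals of
  a vertex and its successor is therefore half the area of the cell, minus that for the predecessor,
  and zero for the opposite vertex of a quadrilateral. Hence the contribution of a cell to the rate of
  change at \<open>n\<close> is, up to a common factor, \<open>q\<close> at the successor of \<open>n\<close> minus \<open>q\<close> at the
  predecessor (\<open>small_cell_corner\<close>). An edge at \<open>n\<close> belongs to two cells,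
  and its other end is the successor of \<open>n\<close> in one and the predecessor in the other, because the cells lie on opposite sides of the edge (\<open>turns_cancel\<close>). So the sum over the
  cells around \<open>n\<close> vanishes.

  The geometric work is to connect this with regions, areas and outward normals defined
  topologically. A simple quadrilateral, possibly nonconvex or with a straight corner, is cut by one
  of its diagonals into two triangles of the same orientation (\<open>simple_quad_diagonal\<close>).
  Their union is starlike, which identifies it with the region enclosed by the edges (\<open>starlike_region\<close>, \<open>quad_cell_region\<close>).
\<close>

section \<open>Signed areas and triangles\<close>

text \<open>The clockwise quarter turn: it takes an edge vector of a counterclockwise polygon to the
  outward direction.\<close>
definition rot :: "point \<Rightarrow> point" where
  "rot d = vector [d $ 2, - (d $ 1)]"

text \<open>Twice the signed area of the triangle, positive for counterclockwise vertices. It is an affine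
  function of each vertex, so it also serves as the equation of the line through two points.\<close>
definition orient :: "point \<Rightarrow> point \<Rightarrow> point \<Rightarrow> real" where
  "orient P Q R = cross2 (Q - P) (R - P)"

lemma rot_nth [simp]: "rot d $ 1 = d $ 2" "rot d $ 2 = - (d $ 1)"
  by (simp_all add: rot_def)

lemma orient_alt:
  "orient P Q R = (Q$1 - P$1) * (R$2 - P$2) - (Q$2 - P$2) * (R$1 - P$1)"
  by (simp add: orient_def cross2_def)

lemma orient_rotate: "orient Q R P = orient P Q R" "orient R P Q = orient P Q R"
  by (simp_all add: orient_alt algebra_simps)

lemma orient_swap: "orient P R Q = - orient P Q R"
  by (simp add: orient_alt algebra_simps)

lemma orient_same [simp]: "orient P P Q = 0" "orient P Q Q = 0" "orient P Q P = 0"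
  by (simp_all add: orient_alt)

lemma orient_add_scaleR: "orient P Q (x + e *\<^sub>R u) = orient P Q x + e * cross2 (Q - P) u"
  by (simp add: orient_alt cross2_def algebra_simps)

lemma orient_combination:
  assumes "u + v + w = 1"
  shows "orient P Q (u *\<^sub>R A + v *\<^sub>R B + w *\<^sub>R C) = u * orient P Q A + v * orient P Q B + w * orient P Q C"
proof -
  have u: "u = 1 - v - w" using assms by simp
  show ?thesis unfolding u by (simp add: orient_alt algebra_simps)
qed

lemma orient_segment:
  "orient P Q ((1 - t) *\<^sub>R A + t *\<^sub>R B) = (1 - t) * orient P Q A + t * orient P Q B"
  using orient_combination[of "1 - t" t 0 P Q A B 0] by simp

lemma continuous_on_orient [continuous_intros]: "continuous_on S (orient P Q)"
  unfolding orient_alt[abs_def] by (intro continuous_intros)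

lemma open_orient_pos: "open {y. 0 < orient P Q y}"
  by (intro open_Collect_less continuous_intros)

lemma norm_rot [simp]: "norm (rot d) = norm d"
  by (simp add: norm_vec_def L2_set_def sum_2)

lemma inner_rot_self [simp]: "rot d \<bullet> d = 0"
  by (simp add: inner_vec_def sum_2)

lemma cross2_rot_rot: "cross2 (rot a) (rot b) = cross2 a b"
  by (simp add: cross2_def)

lemma cross2_rot_self: "cross2 (rot d) d = (norm d)\<^sup>2"
  by (simp add: cross2_def norm_vec_def L2_set_def sum_2 power2_eq_square)

lemma cross2_scaleR: "cross2 (a *\<^sub>R x) y = a * cross2 x y" "cross2 x (a *\<^sub>R y) = a * cross2 x y"
  by (simp_all add: cross2_def algebra_simps)

lemma cross2_minus: "cross2 (- x) y = - cross2 x y" "cross2 x (- y) = - cross2 x y"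
  by (simp_all add: cross2_def algebra_simps)

lemma cross2_commute: "cross2 x y = - cross2 y x"
  by (simp add: cross2_def)

lemma bounded_linear_cross2: "bounded_linear (cross2 a)"
proof -
  have "linear (cross2 a)"
    by (rule linearI) (simp_all add: cross2_def algebra_simps)
  then show ?thesis by (simp add: linear_conv_bounded_linear)
qed

lemma cross2_sum_right: "cross2 a (sum f S) = (\<Sum>x\<in>S. cross2 a (f x))"
  using linear_sum[OF bounded_linear.linear[OF bounded_linear_cross2]] .

lemma unit_normals_opposite:
  assumes "unit_normal s u" "unit_normal s w" "fst s \<noteq> snd s"
  shows "w = u \<or> w = - u"
proof -
  define d where "d = snd s - fst s"
  have d0: "d $ 1 \<noteq> 0 \<or> d $ 2 \<noteq> 0"
    using assms(3) by (auto simp: d_def vec_eq_iff forall_2)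
  have n: "u$1 * u$1 + u$2 * u$2 = 1" "w$1 * w$1 + w$2 * w$2 = 1"
    using assms(1,2) by (simp_all add: unit_normal_def norm_vec_def L2_set_def sum_2 power2_eq_square)
  have o: "u$1 * d$1 + u$2 * d$2 = 0" "w$1 * d$1 + w$2 * d$2 = 0"
    using assms(1,2) by (simp_all add: unit_normal_def d_def inner_vec_def sum_2)
  have "d $ 1 * (u$1 * w$2 - u$2 * w$1) = 0" "d $ 2 * (u$1 * w$2 - u$2 * w$1) = 0"
    using o by algebra+
  then have z: "u$1 * w$2 = u$2 * w$1" using d0 by auto
  \<comment> \<open>the cosine of the angle between the two normals, both orthogonal to the same direction\<close>
  define k where "k = u$1 * w$1 + u$2 * w$2"
  have k1: "k * k = 1"
    unfolding k_def using n z by algebra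
  have w: "w $ 1 = k * u $ 1" "w $ 2 = k * u $ 2"
    unfolding k_def using n z by algebra+
  from k1 have "k = 1 \<or> k = -1" by (simp add: square_eq_1_iff)
  then show ?thesis using w by (auto simp: vec_eq_iff forall_2)
qed

text \<open>The three values of \<^const>\<open>orient\<close>, divided by \<^term>\<open>orient A B C\<close>, are the barycentric
  coordinates of \<^term>\<open>y\<close>.\<close>
lemma triangle_iff:
  assumes "0 < orient A B C"
  shows "y \<in> convex hull {A, B, C} \<longleftrightarrow>
    0 \<le> orient A B y \<and> 0 \<le> orient B C y \<and> 0 \<le> orient C A y"
proof
  assume "y \<in> convex hull {A, B, C}"
  then obtain u v w where uvw: "0 \<le> u" "0 \<le> v" "0 \<le> w" "u + v + w = 1"
    and y: "y = u *\<^sub>R A + v *\<^sub>R B + w *\<^sub>R C"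
    by (auto simp: convex_hull_3)
  show "0 \<le> orient A B y \<and> 0 \<le> orient B C y \<and> 0 \<le> orient C A y"
    unfolding y orient_combination[OF uvw(4)]
    using uvw assms by (simp add: orient_rotate)
next
  assume y: "0 \<le> orient A B y \<and> 0 \<le> orient B C y \<and> 0 \<le> orient C A y"
  define S where "S = orient A B C"
  have S: "S > 0" using assms by (simp add: S_def)
  have sum: "orient B C y + orient C A y + orient A B y = S"
    by (simp add: S_def orient_alt algebra_simps)
  have "S *\<^sub>R y = orient B C y *\<^sub>R A + orient C A y *\<^sub>R B + orient A B y *\<^sub>R C"
    by (simp add: S_def vec_eq_iff forall_2 orient_alt algebra_simps)
  then have "y = (1 / S) *\<^sub>R (orient B C y *\<^sub>R A + orient C A y *\<^sub>R B + orient A B y *\<^sub>R C)"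
    using S by (metis divide_inverse_commute inverse_eq_divide less_numeral_extra(3) scaleR_one
      scaleR_scaleR right_inverse mult.commute mult_1)
  then have "y = (orient B C y / S) *\<^sub>R A + (orient C A y / S) *\<^sub>R B + (orient A B y / S) *\<^sub>R C"
    by (simp add: scaleR_add_right)
  moreover have "orient B C y / S + orient C A y / S + orient A B y / S = 1"
    using sum S by (simp flip: add_divide_distrib)
  ultimately show "y \<in> convex hull {A, B, C}"
    unfolding convex_hull_3 using y S
    by (intro CollectI exI[of _ "orient B C y / S"] exI[of _ "orient C A y / S"]
        exI[of _ "orient A B y / S"]) simp
qed

lemma triangle_side:
  assumes "0 < orient A B C" "y \<in> convex hull {A, B, C}" "orient A B y = 0"
  shows "y \<in> convex hull {A, B}"
proof -
  obtain u v w where uvw: "0 \<le> u" "0 \<le> v" "0 \<le> w" "u + v + w = 1"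
    and y: "y = u *\<^sub>R A + v *\<^sub>R B + w *\<^sub>R C"
    using assms(2) by (auto simp: convex_hull_3)
  have "w * orient A B C = 0"
    using assms(3) unfolding y orient_combination[OF uvw(4)] by simp
  then have "w = 0" using assms(1) by simp
  then show ?thesis using uvw y by (auto simp: convex_hull_2)
qed

lemma triangle_interior:
  assumes "0 < orient A B C" "0 < orient A B y" "0 < orient B C y" "0 < orient C A y"
  shows "y \<in> interior (convex hull {A, B, C})"
proof (rule interiorI)
  let ?U = "{z. 0 < orient A B z} \<inter> {z. 0 < orient B C z} \<inter> {z. 0 < orient C A z}"
  show "open ?U" by (intro open_Int open_orient_pos)
  show "y \<in> ?U" using assms by simp
  show "?U \<subseteq> convex hull {A, B, C}" using assms(1) by (auto simp: triangle_iff)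
qed

lemma content_triangle_orient:
  assumes "0 < orient A B C"
  shows "measure lebesgue (convex hull {A, B, C}) = orient A B C / 2"
proof -
  have "measure lebesgue (convex hull {A, B, C}) = measure lborel (convex hull {A, B, C})"
    by (simp add: measure_completion finite_imp_compact_convex_hull borel_compact)
  then show ?thesis
    using assms unfolding content_triangle by (simp add: orient_alt algebra_simps)
qed

lemma lmeasurable_triangle: "convex hull {A, B, C :: point} \<in> lmeasurable"
  by (simp add: finite_imp_compact_convex_hull lmeasurable_compact)

lemma compact_triangle: "compact (convex hull {A, B, C :: point})"
  by (simp add: finite_imp_compact_convex_hull)

section \<open>Regions bounded by segments\<close>

text \<open>This is what makes \<^const>\<open>cell_region\<close> computable without the Jordan curve theorem.
  A point of \<^term>\<open>K\<close> off \<^term>\<open>G\<close> is interior, hence enclosed by the frontier; a point outside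
  \<^term>\<open>K\<close> escapes to infinity along the ray leading away from the centre \<^term>\<open>a\<close>.\<close>
lemma starlike_region:
  fixes K :: "point set"
  assumes "compact K" "frontier K \<subseteq> G" "G \<subseteq> K"
    and a: "a \<in> K" "\<And>x. x \<in> K \<Longrightarrow> closed_segment a x \<subseteq> K"
  shows "G \<union> inside G = K"
proof -
  have "x \<in> K" if x: "x \<in> inside G" for x
  proof (rule ccontr)
    assume "x \<notin> K"
    define f where "f = (\<lambda>t::real. a + t *\<^sub>R (x - a))"
    have "x \<noteq> a" using a \<open>x \<notin> K\<close> by auto
    have out: "f t \<notin> K" if "t \<ge> 1" for t
    proof
      assume "f t \<in> K"
      then have "closed_segment a (f t) \<subseteq> K" by (rule a(2))
      moreover have "x \<in> closed_segment a (f t)"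
        unfolding closed_segment_def f_def using that
        by (auto simp: algebra_simps intro!: exI[of _ "1/t"])
      ultimately show False using \<open>x \<notin> K\<close> by auto
    qed
    have "connected (f ` {1..})"
      unfolding f_def by (intro connected_continuous_image continuous_intros) simp
    moreover have "x \<in> f ` {1..}"
      by (rule image_eqI[of _ _ 1]) (simp_all add: f_def)
    moreover have "f ` {1..} \<subseteq> - G" using out assms(3) by auto
    ultimately have sub: "f ` {1..} \<subseteq> connected_component_set (- G) x"
      by (simp add: connected_component_maximal)
    have "bounded (connected_component_set (- G) x)"
      using x by (simp add: inside_def)
    then have "bounded (f ` {1..})" using sub bounded_subset by blast
    then obtain M where M: "\<And>t. t \<ge> 1 \<Longrightarrow> dist a (f t) \<le> M"
      unfolding bounded_any_center[of _ a] by auto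
    \<comment> \<open>far enough on the ray to violate the bound\<close>
    define t where "t = max 1 ((M + 1) / norm (x - a))"
    have "dist a (f t) = t * norm (x - a)"
      by (simp add: f_def dist_norm t_def)
    also have "\<dots> \<ge> ((M + 1) / norm (x - a)) * norm (x - a)"
      by (intro mult_right_mono) (auto simp: t_def)
    also have "((M + 1) / norm (x - a)) * norm (x - a) = M + 1"
      using \<open>x \<noteq> a\<close> by simp
    finally show False using M[of t] by (simp add: t_def)
  qed
  moreover have "x \<in> G \<union> inside G" if "x \<in> K" for x
  proof (cases "x \<in> G")
    case False
    then have "x \<in> interior K"
      using that assms(1,2) by (auto simp: frontier_def compact_imp_closed)
    then have "x \<in> inside (frontier K)"
      using interior_inside_frontier[OF compact_imp_bounded[OF assms(1)]] by auto
    then show ?thesis using inside_mono[OF assms(2)] by auto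
  qed simp
  ultimately show ?thesis using assms(3) by blast
qed

section \<open>Outward normals\<close>

definition ccw_normal :: "point \<Rightarrow> point \<Rightarrow> point" where
  "ccw_normal P Q = (1 / dist P Q) *\<^sub>R rot (Q - P)"

text \<open>The edge is traversed so that the cell lies on its left. The interior condition is there to
  compare two cells that share the edge: overlapping cells are excluded only through their interiors.\<close>
definition ccw_edge :: "cell \<Rightarrow> point \<Rightarrow> point \<Rightarrow> bool" where
  "ccw_edge c P Q \<longleftrightarrow> P \<noteq> Q \<and> (\<forall>x\<in>open_segment P Q.
     (\<forall>\<^sub>F \<epsilon> in at_right 0. x + \<epsilon> *\<^sub>R ccw_normal P Q \<notin> cell_region c) \<and>
     (\<forall>\<^sub>F \<epsilon> in at_right 0. x - \<epsilon> *\<^sub>R ccw_normal P Q \<in> interior (cell_region c)))"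

lemma tendsto_shift: "((\<lambda>\<epsilon>::real. x + \<epsilon> *\<^sub>R u) \<longlongrightarrow> (x::point)) (at_right 0)"
  by (rule tendsto_eq_intros refl | simp)+

lemma eventually_shift:
  fixes x u :: point
  assumes "open U" "x \<in> U"
  shows "\<forall>\<^sub>F \<epsilon> in at_right 0. x + \<epsilon> *\<^sub>R u \<in> U"
  by (rule topological_tendstoD[OF tendsto_shift assms])

text \<open>Near the open edge the cell looks like the triangle built on it: the rest \<^term>\<open>H\<close> of the
  cell is closed and misses the edge, so small normal displacements do not reach it.\<close>
lemma ccw_edgeI:
  assumes pos: "0 < orient P Q S"
    and sub: "convex hull {P, Q, S} \<subseteq> cell_region c"
    and sup: "cell_region c \<subseteq> convex hull {P, Q, S} \<union> H"
    and H: "closed H" "open_segment P Q \<inter> H = {}"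
  shows "ccw_edge c P Q"
proof -
  define u where "u = ccw_normal P Q"
  have "P \<noteq> Q" using pos by auto
  then have d: "cross2 (Q - P) u < 0"
    using cross2_rot_self[of "Q - P"]
    by (simp add: u_def ccw_normal_def cross2_scaleR cross2_commute[of "Q - P"] divide_pos_pos)
  have "(\<forall>\<^sub>F \<epsilon> in at_right 0. x + \<epsilon> *\<^sub>R u \<notin> cell_region c) \<and>
        (\<forall>\<^sub>F \<epsilon> in at_right 0. x - \<epsilon> *\<^sub>R u \<in> interior (cell_region c))"
    if x: "x \<in> open_segment P Q" for x
  proof
    obtain t where t: "0 < t" "t < 1" "x = (1 - t) *\<^sub>R P + t *\<^sub>R Q"
      using x by (auto simp: in_segment)
    have x0: "orient P Q x = 0" "0 < orient Q S x" "0 < orient S P x"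
      using t pos unfolding t(3) orient_segment by (simp_all add: orient_rotate)
    have pos0: "\<forall>\<^sub>F \<epsilon> in at_right 0. (\<epsilon>::real) > 0"
      by (simp add: eventually_at_right_less)
    have "\<forall>\<^sub>F \<epsilon> in at_right 0. x + \<epsilon> *\<^sub>R u \<in> - H"
      by (rule eventually_shift) (use H x in auto)
    with pos0 show "\<forall>\<^sub>F \<epsilon> in at_right 0. x + \<epsilon> *\<^sub>R u \<notin> cell_region c"
    proof eventually_elim
      case (elim \<epsilon>)
      have "orient P Q (x + \<epsilon> *\<^sub>R u) < 0"
        using d elim(1) x0 by (simp add: orient_add_scaleR mult_pos_neg)
      then have "x + \<epsilon> *\<^sub>R u \<notin> convex hull {P, Q, S}"
        by (simp add: triangle_iff[OF pos])
      then show ?case using elim sup by auto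
    qed
    have "\<forall>\<^sub>F \<epsilon> in at_right 0. x + \<epsilon> *\<^sub>R (- u) \<in> {y. 0 < orient Q S y} \<inter> {y. 0 < orient S P y}"
      by (rule eventually_shift) (use x0 open_orient_pos in auto)
    with pos0 show "\<forall>\<^sub>F \<epsilon> in at_right 0. x - \<epsilon> *\<^sub>R u \<in> interior (cell_region c)"
    proof eventually_elim
      case (elim \<epsilon>)
      have "orient P Q (x + \<epsilon> *\<^sub>R (- u)) > 0"
        using d elim(1) x0 unfolding orient_add_scaleR by (simp add: cross2_minus mult_pos_neg)
      then have "x + \<epsilon> *\<^sub>R (- u) \<in> interior (convex hull {P, Q, S})"
        using elim by (intro triangle_interior pos) auto
      then show ?case using interior_mono[OF sub] by auto
    qed
  qed
  then show ?thesis using \<open>P \<noteq> Q\<close> by (auto simp: ccw_edge_def u_def)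
qed

text \<open>Only two unit normals are available, and the inner condition disqualifies the opposite one.
  This makes the description in \<^const>\<open>outward_normal\<close> definite.\<close>
lemma outward_normal_eq:
  assumes "fst s \<noteq> snd s" "unit_normal s u"
    and out: "\<And>x. x \<in> open_segment (fst s) (snd s) \<Longrightarrow> \<forall>\<^sub>F \<epsilon> in at_right 0. x + \<epsilon> *\<^sub>R u \<notin> cell_region c"
    and inn: "\<And>x. x \<in> open_segment (fst s) (snd s) \<Longrightarrow> \<forall>\<^sub>F \<epsilon> in at_right 0. x - \<epsilon> *\<^sub>R u \<in> interior (cell_region c)"
  shows "outward_normal s c = u"
  unfolding outward_normal_def
proof (rule the_equality)
  show "unit_normal s u \<and> (\<forall>x\<in>open_segment (fst s) (snd s). \<forall>\<^sub>F \<epsilon> in at_right 0. x + \<epsilon> *\<^sub>R u \<notin> cell_region c)"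
    using assms by blast
next
  fix w
  assume w: "unit_normal s w \<and> (\<forall>x\<in>open_segment (fst s) (snd s). \<forall>\<^sub>F \<epsilon> in at_right 0. x + \<epsilon> *\<^sub>R w \<notin> cell_region c)"
  show "w = u"
  proof (rule ccontr)
    assume "w \<noteq> u"
    then have wu: "w = - u" using unit_normals_opposite[OF assms(2) _ assms(1)] w by blast
    obtain x where x: "x \<in> open_segment (fst s) (snd s)"
      using assms(1) by (metis ex_in_conv open_segment_eq_empty)
    have "\<forall>\<^sub>F \<epsilon> in at_right (0::real). False"
      using inn[OF x] w[THEN conjunct2, rule_format, OF x]
      by eventually_elim (use interior_subset wu in auto)
    then show False by simp
  qed
qed

lemma ccw_edge_normal:
  assumes "ccw_edge c P Q"
  shows "outward_normal (P, midpoint P Q) c = ccw_normal P Q"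
    and "outward_normal (Q, midpoint Q P) c = ccw_normal P Q"
proof -
  have "P \<noteq> Q" using assms by (simp add: ccw_edge_def)
  have u: "norm (ccw_normal P Q) = 1" "ccw_normal P Q \<bullet> (Q - P) = 0"
    using \<open>P \<noteq> Q\<close> by (simp_all add: ccw_normal_def dist_norm norm_minus_commute)
  have m: "midpoint P Q - P = (1/2) *\<^sub>R (Q - P)" "midpoint Q P - Q = - (1/2) *\<^sub>R (Q - P)"
    by (simp_all add: midpoint_def vec_eq_iff algebra_simps)
  have un: "unit_normal (P, midpoint P Q) (ccw_normal P Q)"
    "unit_normal (Q, midpoint Q P) (ccw_normal P Q)"
    using u unfolding unit_normal_def fst_conv snd_conv m inner_scaleR_right by simp_all
  have "open_segment P (midpoint P Q) \<subseteq> open_segment P Q"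
    "open_segment Q (midpoint Q P) \<subseteq> open_segment P Q"
    using midpoint_in_closed_segment[of P Q]
    by (auto simp: subset_open_segment open_segment_commute midpoint_sym[of Q P])
  moreover have "P \<noteq> midpoint P Q" "Q \<noteq> midpoint Q P"
    using \<open>P \<noteq> Q\<close> midpoint_eq_endpoint(1)[of P Q] midpoint_eq_endpoint(1)[of Q P] by metis+
  ultimately show "outward_normal (P, midpoint P Q) c = ccw_normal P Q"
    and "outward_normal (Q, midpoint Q P) c = ccw_normal P Q"
    using assms \<open>P \<noteq> Q\<close> un by (auto simp: ccw_edge_def intro!: outward_normal_eq)
qed

section \<open>Simple triangles and quadrilaterals\<close>

lemma collinear_if_orient_0:
  assumes "orient P Q R = 0"
  shows "collinear {P, Q, R}"
proof (cases "P = Q")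
  case False
  define k where "k = (if Q$1 \<noteq> P$1 then (R$1 - P$1) / (Q$1 - P$1) else (R$2 - P$2) / (Q$2 - P$2))"
  have o: "(Q$1 - P$1) * (R$2 - P$2) = (Q$2 - P$2) * (R$1 - P$1)"
    using assms by (simp add: orient_alt)
  have "Q$1 = P$1 \<Longrightarrow> Q$2 \<noteq> P$2" using False by (auto simp: vec_eq_iff forall_2)
  moreover from this have "Q$1 = P$1 \<Longrightarrow> R$1 = P$1" using o by auto
  ultimately have "R - P = k *\<^sub>R (Q - P)"
    using o by (auto simp: k_def vec_eq_iff forall_2 field_simps)
  then have "R = (1 - k) *\<^sub>R P + k *\<^sub>R Q" by (simp add: algebra_simps)
  then have "R = k *\<^sub>R Q + (1 - k) *\<^sub>R P" by simp
  then have "collinear {Q, R, P}" unfolding collinear_3_expand by blast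
  then show ?thesis by (simp add: insert_commute)
qed simp

text \<open>The parameters of the intersection point are the ratios in which each line divides the other
  segment; the signs place both of them strictly between 0 and 1.\<close>
lemma segments_cross:
  assumes "orient P Q R * orient P Q S < 0" "orient R S P * orient R S Q < 0"
  shows "convex hull {P, Q} \<inter> convex hull {R, S} \<noteq> {}"
proof -
  define a b d e where ab: "a = orient R S P" "b = orient R S Q" "d = orient P Q R" "e = orient P Q S"
  have *: "0 < x / (x - y) \<and> x / (x - y) < 1" if "x * y < 0" for x y :: real
    using that by (auto simp: mult_less_0_iff field_simps)
  have ab0: "0 < a / (a - b) \<and> a / (a - b) < 1" "0 < d / (d - e) \<and> d / (d - e) < 1"
    using assms *[of a b] *[of d e] by (simp_all add: ab mult.commute)
  have ne: "a - b \<noteq> 0" "d - e \<noteq> 0" using ab0 by auto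
  have rel: "a - b = - (d - e)" by (simp add: ab orient_alt algebra_simps)
  let ?x = "(1 - a / (a - b)) *\<^sub>R P + (a / (a - b)) *\<^sub>R Q"
  let ?y = "(1 - d / (d - e)) *\<^sub>R R + (d / (d - e)) *\<^sub>R S"
  have "k *\<^sub>R ((1 - t) *\<^sub>R X + t *\<^sub>R Y) = k *\<^sub>R X + (k * t) *\<^sub>R (Y - X)" for k t and X Y :: point
    by (simp add: vec_eq_iff algebra_simps)
  then have scale: "(a - b) *\<^sub>R ?x = (a - b) *\<^sub>R P + a *\<^sub>R (Q - P)"
      "(d - e) *\<^sub>R ?y = (d - e) *\<^sub>R R + d *\<^sub>R (S - R)"
    using ne by simp_all
  have "(a - b) *\<^sub>R P + a *\<^sub>R (Q - P) = - ((d - e) *\<^sub>R R + d *\<^sub>R (S - R))"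
    unfolding ab by (simp add: vec_eq_iff forall_2 orient_alt algebra_simps)
  also have "\<dots> = - ((d - e) *\<^sub>R ?y)" by (simp only: scale)
  also have "\<dots> = (a - b) *\<^sub>R ?y" by (simp only: rel scaleR_minus_left)
  finally have "?x = ?y" unfolding scale(1)[symmetric] using ne by simp
  moreover have "?x \<in> closed_segment P Q" "?y \<in> closed_segment R S"
    using ab0 by (auto simp: closed_segment_def simp del: less_divide_eq_1 divide_less_eq_1 zero_less_divide_iff)
  ultimately show ?thesis by (auto simp: segment_convex_hull)
qed

text \<open>The condition that \<^const>\<open>simple_polygon\<close> imposes on two distinct edges.\<close>
definition meets_in_ends :: "point set \<Rightarrow> point set \<Rightarrow> bool" where
  "meets_in_ends e e' \<longleftrightarrow> convex hull e \<inter> convex hull e' \<subseteq> e \<inter> e'"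

lemma simple_triangle_orient:
  assumes "distinct [A, B, C]" "meets_in_ends {A, B} {B, C}" "meets_in_ends {B, C} {C, A}"
    "meets_in_ends {C, A} {A, B}"
  shows "orient A B C \<noteq> 0"
proof
  assume "orient A B C = 0"
  then have "collinear {A, B, C}" by (rule collinear_if_orient_0)
  then have "A \<in> convex hull {B, C} \<or> B \<in> convex hull {C, A} \<or> C \<in> convex hull {A, B}"
    by (auto simp: collinear_between_cases between_mem_segment segment_convex_hull)
  moreover have "convex hull {A, B} \<inter> convex hull {B, C} \<subseteq> {B}"
    "convex hull {B, C} \<inter> convex hull {C, A} \<subseteq> {C}" "convex hull {C, A} \<inter> convex hull {A, B} \<subseteq> {A}"
    using assms unfolding meets_in_ends_def by auto
  moreover have "A \<in> convex hull {A, B}" "B \<in> convex hull {B, C}" "C \<in> convex hull {C, A}"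
    by (auto intro: hull_inc)
  ultimately show False using assms(1) by auto
qed

definition simple_quad :: "point \<Rightarrow> point \<Rightarrow> point \<Rightarrow> point \<Rightarrow> bool" where
  "simple_quad A B C D \<longleftrightarrow> distinct [A, B, C, D] \<and>
     meets_in_ends {A, B} {B, C} \<and> meets_in_ends {B, C} {C, D} \<and>
     meets_in_ends {C, D} {D, A} \<and> meets_in_ends {D, A} {A, B} \<and>
     meets_in_ends {A, B} {C, D} \<and> meets_in_ends {B, C} {D, A}"

lemma simple_quad_rotate: "simple_quad A B C D \<Longrightarrow> simple_quad B C D A"
  by (auto simp: simple_quad_def meets_in_ends_def)

text \<open>A straight corner is allowed. Then \<^term>\<open>B\<close> lies strictly between \<^term>\<open>A\<close> and \<^term>\<open>C\<close>, and
  the line through \<^term>\<open>B\<close> and \<^term>\<open>D\<close> separates them.\<close>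
lemma simple_quad_straight:
  assumes "simple_quad A B C D" "orient A B C = 0"
  shows "0 < orient A B D * orient B C D"
proof -
  have q: "distinct [A, B, C, D]"
    "convex hull {A, B} \<inter> convex hull {B, C} \<subseteq> {B}"
    "convex hull {C, D} \<inter> convex hull {D, A} \<subseteq> {D}"
    "convex hull {B, C} \<inter> convex hull {C, D} \<subseteq> {C}"
    "convex hull {D, A} \<inter> convex hull {A, B} \<subseteq> {A}"
    "convex hull {A, B} \<inter> convex hull {C, D} = {}" "convex hull {B, C} \<inter> convex hull {D, A} = {}"
    using assms(1) unfolding simple_quad_def meets_in_ends_def by auto
  have ends: "P \<in> convex hull {P, Q}" "P \<in> convex hull {Q, P}" for P Q :: point
    by (auto intro: hull_inc)
  have "collinear {A, B, C}" using assms(2) by (rule collinear_if_orient_0)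
  then have "A \<in> convex hull {B, C} \<or> B \<in> convex hull {C, A} \<or> C \<in> convex hull {A, B}"
    by (auto simp: collinear_between_cases between_mem_segment segment_convex_hull)
  moreover have "A \<notin> convex hull {B, C}" "C \<notin> convex hull {A, B}" using q ends by auto
  ultimately have "B \<in> closed_segment A C"
    by (auto simp: segment_convex_hull insert_commute)
  then obtain t where t: "B = (1 - t) *\<^sub>R A + t *\<^sub>R C" "0 \<le> t" "t \<le> 1"
    by (auto simp: closed_segment_def)
  have "t \<noteq> 0" "t \<noteq> 1" using t q(1) by auto
  then have t01: "0 < t" "t < 1" using t by auto
  \<comment> \<open>both factors are positive multiples of the same area, so only its vanishing has to be excluded\<close>
  have de: "orient A B D = t * orient A C D" "orient B C D = (1 - t) * orient A C D"
    unfolding t(1) by (simp_all add: orient_alt algebra_simps)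
  have "orient A C D \<noteq> 0"
  proof
    assume z: "orient A C D = 0"
    have "collinear {A, C, D}" using z by (rule collinear_if_orient_0)
    then have "A \<in> convex hull {C, D} \<or> C \<in> convex hull {D, A} \<or> D \<in> convex hull {A, C}"
      by (auto simp: collinear_between_cases between_mem_segment segment_convex_hull)
    moreover have "A \<notin> convex hull {C, D}" "C \<notin> convex hull {D, A}"
      using q ends(1)[of A B] ends(2)[of C B] by blast+
    moreover have "convex hull {A, C} = convex hull {A, B} \<union> convex hull {B, C}"
      using Un_closed_segment[OF \<open>B \<in> closed_segment A C\<close>] by (simp add: segment_convex_hull)
    moreover have "D \<notin> convex hull {A, B}" "D \<notin> convex hull {B, C}"
      using q ends(1)[of D A] ends(2)[of D C] by blast+
    ultimately show False by auto
  qed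
  then have "0 < orient A C D * orient A C D" using not_real_square_gt_zero by blast
  then have "0 < (t * (1 - t)) * (orient A C D * orient A C D)"
    using t01 by (intro mult_pos_pos[of "t * (1 - t)"] mult_pos_pos[of t]) auto
  then show ?thesis unfolding de by (simp add: algebra_simps)
qed

text \<open>At least one diagonal cuts a simple quadrilateral, convex or not, into two triangles of the same
  orientation. The two signed areas of either splitting have the same sum. If both splittings had
  areas of strictly opposite signs, one pair of opposite edges would cross; a vanishing area means a
  straight corner.\<close>
lemma simple_quad_diagonal:
  assumes "simple_quad A B C D"
  shows "0 < orient A B C * orient A C D \<or> 0 < orient B C D * orient B D A"
proof -
  define a b d e where abde: "a = orient A B C" "b = orient A C D" "d = orient B D A" "e = orient B C D"
  have sum: "a + b = d + e" by (simp add: abde orient_alt algebra_simps)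
  note q1 = assms note q2 = simple_quad_rotate[OF q1]
  note q3 = simple_quad_rotate[OF q2] note q4 = simple_quad_rotate[OF q3]
  have str: "a = 0 \<Longrightarrow> 0 < d * e" "e = 0 \<Longrightarrow> 0 < a * b" "b = 0 \<Longrightarrow> 0 < d * e" "d = 0 \<Longrightarrow> 0 < a * b"
    using simple_quad_straight[OF q1] simple_quad_straight[OF q2] simple_quad_straight[OF q3]
      simple_quad_straight[OF q4]
    by (simp_all add: abde orient_rotate mult.commute)
  have disj: "convex hull {A, B} \<inter> convex hull {C, D} = {}" "convex hull {B, C} \<inter> convex hull {D, A} = {}"
    using q1 unfolding simple_quad_def meets_in_ends_def by auto
  have c1: "\<not> (a * d < 0 \<and> b * e < 0)"
    using segments_cross[of A B C D] disj(1)
    by (auto simp: abde orient_rotate mult.commute)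
  have c2: "\<not> (a * e < 0 \<and> b * d < 0)"
    using segments_cross[of B C D A] disj(2)
    by (auto simp: abde orient_rotate mult.commute)
  have "0 < a * b \<or> 0 < d * e"
    using str c1 c2 sum unfolding zero_less_mult_iff mult_less_0_iff by (smt (verit))
  then show ?thesis by (simp add: abde mult.commute)
qed

lemma cell_edges_image: "cell_edges c = (\<lambda>i. {c ! i, c ! (Suc i mod length c)}) ` {..<length c}"
  unfolding cell_edges_def by blast

lemma cell_edges_triangle: "cell_edges [A, B, C] = {{A, B}, {B, C}, {C, A}}"
proof -
  have "{..<length [A, B, C]} = {0, Suc 0, Suc (Suc 0)}" by auto
  then show ?thesis unfolding cell_edges_image by simp
qed

lemma cell_edges_quad: "cell_edges [A, B, C, D] = {{A, B}, {B, C}, {C, D}, {D, A}}"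
proof -
  have "{..<length [A, B, C, D]} = {0, Suc 0, Suc (Suc 0), Suc (Suc (Suc 0))}" by auto
  then show ?thesis unfolding cell_edges_image by simp
qed

lemma card_cell_edges:
  assumes "3 \<le> length c" "distinct c"
  shows "card (cell_edges c) = length c"
proof -
  let ?n = "length c" and ?e = "\<lambda>i. {c ! i, c ! (Suc i mod length c)}"
  have "inj_on ?e {..<?n}"
  proof (rule inj_onI)
    fix i j assume ij: "i \<in> {..<?n}" "j \<in> {..<?n}" and eq: "?e i = ?e j"
    have lt: "Suc k mod ?n < ?n" for k using assms(1) by (intro mod_less_divisor) linarith
    have nth: "c ! k = c ! l \<longleftrightarrow> k = l" if "k < ?n" "l < ?n" for k l
      using that assms(2) nth_eq_iff_index_eq by blast
    have "i = j \<or> (i = Suc j mod ?n \<and> Suc i mod ?n = j)"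
      using eq ij lt unfolding doubleton_eq_iff by (auto simp: nth)
    then show "i = j"
      using ij assms(1) by (auto simp: mod_Suc split: if_splits)
  qed
  moreover have "cell_edges c = ?e ` {..<?n}" by (rule cell_edges_image)
  ultimately show ?thesis by (simp add: card_image)
qed

text \<open>A normal form up to rotation and reversal of the vertex list, which change neither the vertex
  set nor the edge set. In the second case the diagonal from \<^term>\<open>A\<close> to \<^term>\<open>C\<close> is the one that lies inside
  the cell.\<close>
lemma small_cell_cases:
  assumes "simple_polygon c" "card (cell_edges c) \<le> 4"
  obtains (triangle) A B C where "set c = {A, B, C}" "cell_edges c = {{A, B}, {B, C}, {C, A}}"
      "0 < orient A B C"
  | (quad) A B C D where "set c = {A, B, C, D}" "cell_edges c = {{A, B}, {B, C}, {C, D}, {D, A}}"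
      "distinct [A, B, C, D]" "0 < orient A B C" "0 < orient A C D"
proof -
  have c: "3 \<le> length c" "distinct c" using assms(1) by (auto simp: simple_polygon_def)
  have meets: "meets_in_ends e e'" if "e \<in> cell_edges c" "e' \<in> cell_edges c" "e \<noteq> e'" for e e'
    using assms(1) that by (auto simp: simple_polygon_def meets_in_ends_def)
  have "length c = 3 \<or> length c = 4" using c card_cell_edges[OF c] assms(2) by auto
  then show ?thesis
  proof
    assume "length c = 3"
    then obtain A B C where ABC: "c = [A, B, C]"
      by (auto simp: numeral_3_eq_3 length_Suc_conv)
    note E = cell_edges_triangle[of A B C]
    have "orient A B C \<noteq> 0"
      using c(2) meets unfolding ABC E
      by (intro simple_triangle_orient) (auto simp: doubleton_eq_iff)
    then consider "0 < orient A B C" | "0 < orient A C B" using orient_swap[of A C B] by linarith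
    then show ?thesis
      by cases (rule triangle[of A B C] triangle[of A C B]; auto simp: ABC E insert_commute)+
  next
    assume "length c = 4"
    then obtain A B C D where ABCD: "c = [A, B, C, D]"
      by (auto simp: eval_nat_numeral length_Suc_conv)
    note E = cell_edges_quad[of A B C D]
    have dist: "distinct [A, B, C, D]" using c ABCD by simp
    have "simple_quad A B C D"
      using dist meets unfolding ABCD E simple_quad_def by (auto simp: doubleton_eq_iff)
    from simple_quad_diagonal[OF this]
    consider "0 < orient A B C" "0 < orient A C D" | "0 < orient A D C" "0 < orient A C B"
      | "0 < orient B C D" "0 < orient B D A" | "0 < orient B A D" "0 < orient B D C"
      using orient_swap[of A D C] orient_swap[of A C B] orient_swap[of B A D] orient_swap[of B D C]
      unfolding zero_less_mult_iff by (smt (verit))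
    then show ?thesis
    proof cases
      case 1
      then show ?thesis by (intro quad[of A B C D]) (use dist in \<open>auto simp: ABCD E insert_commute\<close>)
    next
      case 2
      then show ?thesis by (intro quad[of A D C B]) (use dist in \<open>auto simp: ABCD E insert_commute\<close>)
    next
      case 3
      then show ?thesis by (intro quad[of B C D A]) (use dist in \<open>auto simp: ABCD E insert_commute\<close>)
    next
      case 4
      then show ?thesis by (intro quad[of B A D C]) (use dist in \<open>auto simp: ABCD E insert_commute\<close>)
    qed
  qed
qed

section \<open>Regions and areas of cells\<close>

lemma triangle_frontier:
  assumes "0 < orient A B C" "x \<in> frontier (convex hull {A, B, C})"
  shows "x \<in> convex hull {A, B} \<union> convex hull {B, C} \<union> convex hull {C, A}"
proof -
  have x: "x \<in> convex hull {A, B, C}" "x \<notin> interior (convex hull {A, B, C})"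
    using assms(2) compact_triangle[of A B C] by (auto simp: frontier_def compact_imp_closed)
  then have "orient A B x = 0 \<or> orient B C x = 0 \<or> orient C A x = 0"
    using triangle_interior[OF assms(1), of x] by (auto simp: triangle_iff[OF assms(1)] less_le)
  moreover have "{B, C, A} = {A, B, C}" "{C, A, B} = {A, B, C}" by auto
  ultimately show ?thesis
    using triangle_side[of A B C x] triangle_side[of B C A x] triangle_side[of C A B x] x assms(1)
    by (auto simp: orient_rotate)
qed

lemma triangle_cell_region:
  assumes E: "cell_edges c = {{A, B}, {B, C}, {C, A}}" and pos: "0 < orient A B C"
  shows "cell_region c = convex hull {A, B, C}"
proof -
  let ?K = "convex hull {A, B, C}"
  have G: "cell_boundary c = convex hull {A, B} \<union> convex hull {B, C} \<union> convex hull {C, A}"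
    by (auto simp: cell_boundary_def E)
  show ?thesis unfolding cell_region_def
  proof (rule starlike_region)
    show "compact ?K" by (rule compact_triangle)
    show "frontier ?K \<subseteq> cell_boundary c" unfolding G using triangle_frontier[OF pos] by blast
    show "cell_boundary c \<subseteq> ?K" unfolding G by (intro Un_least hull_mono) auto
    show "A \<in> ?K" by (simp add: hull_inc)
    then show "closed_segment A x \<subseteq> ?K" if "x \<in> ?K" for x
      using that by (simp add: closed_segment_subset)
  qed
qed

text \<open>Close to a point of the open diagonal only the four outer sides could be violated, and every point
  satisfying those four inequalities lies in one of the triangles, according to its side of the diagonal.\<close>
lemma diagonal_interior:
  assumes "0 < orient A B C" "0 < orient A C D" "x \<in> open_segment A C"
  shows "x \<in> interior (convex hull {A, B, C} \<union> convex hull {A, C, D})"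
proof (rule interiorI)
  let ?U = "{z. 0 < orient A B z} \<inter> {z. 0 < orient B C z} \<inter> {z. 0 < orient C D z} \<inter> {z. 0 < orient D A z}"
  obtain t where t: "0 < t" "t < 1" "x = (1 - t) *\<^sub>R A + t *\<^sub>R C"
    using assms(3) by (auto simp: in_segment)
  show "open ?U" by (intro open_Int open_orient_pos)
  show "x \<in> ?U" using t(1,2) assms(1,2) unfolding t(3) Int_iff mem_Collect_eq orient_segment
    by (simp add: orient_rotate)
  show "?U \<subseteq> convex hull {A, B, C} \<union> convex hull {A, C, D}"
  proof
    fix y assume "y \<in> ?U"
    then show "y \<in> convex hull {A, B, C} \<union> convex hull {A, C, D}"
      using orient_swap[of A C y]
      by (auto simp: triangle_iff assms(1,2) orient_rotate)
  qed
qed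

text \<open>The union is starlike about \<^term>\<open>A\<close>, a common point of the two convex triangles.\<close>
lemma quad_cell_region:
  assumes E: "cell_edges c = {{A, B}, {B, C}, {C, D}, {D, A}}"
    and pos: "0 < orient A B C" "0 < orient A C D"
  shows "cell_region c = convex hull {A, B, C} \<union> convex hull {A, C, D}" (is "_ = ?K")
proof -
  have G: "cell_boundary c = convex hull {A, B} \<union> convex hull {B, C} \<union> convex hull {C, D} \<union> convex hull {D, A}"
    by (auto simp: cell_boundary_def E)
  show ?thesis unfolding cell_region_def
  proof (rule starlike_region)
    show "compact ?K" by (intro compact_Un compact_triangle)
    show "frontier ?K \<subseteq> cell_boundary c"
    proof
      fix x assume x: "x \<in> frontier ?K"
      then have "x \<in> frontier (convex hull {A, B, C}) \<or> x \<in> frontier (convex hull {A, C, D})"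
        using frontier_Un_subset by blast
      then have "x \<in> cell_boundary c \<or> x \<in> closed_segment A C"
        using triangle_frontier[OF pos(1)] triangle_frontier[OF pos(2)]
        unfolding G by (auto simp: segment_convex_hull insert_commute)
      moreover have "x \<notin> open_segment A C"
        using x diagonal_interior[OF pos] by (auto simp: frontier_def)
      moreover have "A \<in> cell_boundary c" "C \<in> cell_boundary c" unfolding G by (auto intro: hull_inc)
      ultimately show "x \<in> cell_boundary c" by (auto simp: open_segment_def)
    qed
    show "cell_boundary c \<subseteq> ?K"
    proof -
      have "convex hull {A, B} \<subseteq> convex hull {A, B, C}" "convex hull {B, C} \<subseteq> convex hull {A, B, C}"
        "convex hull {C, D} \<subseteq> convex hull {A, C, D}" "convex hull {D, A} \<subseteq> convex hull {A, C, D}"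
        by (intro hull_mono; auto)+
      then show ?thesis unfolding G by blast
    qed
    show "A \<in> ?K" by (simp add: hull_inc)
    show "closed_segment A x \<subseteq> ?K" if "x \<in> ?K" for x
    proof -
      have "closed_segment A x \<subseteq> convex hull {A, B, C} \<or> closed_segment A x \<subseteq> convex hull {A, C, D}"
        using that
        by (metis UnE closed_segment_subset convex_convex_hull hull_inc insertI1)
      then show ?thesis by auto
    qed
  qed
qed

lemma quad_area:
  assumes pos: "0 < orient A B C" "0 < orient A C D"
  shows "measure lebesgue (convex hull {A, B, C} \<union> convex hull {A, C, D}) = cross2 (C - A) (D - B) / 2"
proof -
  let ?S = "convex hull {A, B, C}" and ?T = "convex hull {A, C, D}"
  have "?S \<inter> ?T \<subseteq> {y. rot (C - A) \<bullet> y = rot (C - A) \<bullet> A}"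
  proof
    fix y assume "y \<in> ?S \<inter> ?T"
    then have "0 \<le> orient C A y" "0 \<le> orient A C y"
      by (auto simp: triangle_iff assms)
    then have "orient A C y = 0" by (simp add: orient_alt algebra_simps)
    then show "y \<in> {y. rot (C - A) \<bullet> y = rot (C - A) \<bullet> A}"
      by (simp add: inner_vec_def sum_2 orient_alt algebra_simps)
  qed
  moreover have "A \<noteq> C" using pos by auto
  then have "rot (C - A) \<noteq> 0" by (auto simp: vec_eq_iff forall_2)
  then have "negligible {y. rot (C - A) \<bullet> y = rot (C - A) \<bullet> A}" by (simp add: negligible_hyperplane)
  ultimately have "negligible (?S \<inter> ?T)" using negligible_subset by blast
  then have "measure lebesgue (?S \<union> ?T) = measure lebesgue ?S + measure lebesgue ?T"
    by (simp add: measure_Un3 lmeasurable_triangle negligible_imp_measure0)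
  also have "\<dots> = cross2 (C - A) (D - B) / 2"
    by (simp add: content_triangle_orient pos) (simp add: orient_alt cross2_def algebra_simps flip: add_divide_distrib)
  finally show ?thesis .
qed

text \<open>Only the two edges of the first triangle: exchanging the roles of the triangles gives the others.\<close>
lemma quad_ccw_edges:
  assumes E: "cell_edges c = {{A, B}, {B, C}, {C, D}, {D, A}}"
    and pos: "0 < orient A B C" "0 < orient A C D"
  shows "ccw_edge c A B" "ccw_edge c B C"
proof -
  have R: "cell_region c = convex hull {A, B, C} \<union> convex hull {A, C, D}"
    by (rule quad_cell_region[OF assms])
  have R': "cell_region c = convex hull {B, C, A} \<union> convex hull {A, C, D}"
    unfolding R by (simp add: insert_commute)
  have neg: "orient A C B < 0" using pos(1) orient_swap[of A C B] by simp
  have closed: "closed (convex hull {A, C, D})" by (simp add: compact_triangle compact_imp_closed)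
  have away: "x \<notin> convex hull {A, C, D}" if "orient A C x < 0" for x
    using that by (simp add: triangle_iff[OF pos(2)])
  show "ccw_edge c A B"
  proof (rule ccw_edgeI[OF pos(1) _ _ closed])
    have "orient A C x < 0" if "x \<in> open_segment A B" for x
      using that neg by (auto simp: in_segment orient_segment mult_pos_neg)
    then show "open_segment A B \<inter> convex hull {A, C, D} = {}" using away by blast
  qed (auto simp: R)
  show "ccw_edge c B C"
  proof (rule ccw_edgeI[OF _ _ _ closed])
    show "0 < orient B C A" using pos(1) by (simp add: orient_rotate)
    have "orient A C x < 0" if "x \<in> open_segment B C" for x
      using that neg by (auto simp: in_segment orient_segment mult_pos_neg)
    then show "open_segment B C \<inter> convex hull {A, C, D} = {}" using away by blast
  qed (auto simp: R')
qed

section \<open>Node-normals and their cross products\<close>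

lemma subedges_of_image: "subedges_of n c = (\<lambda>m. (n, midpoint n m)) ` {m. {n, m} \<in> cell_edges c}"
  by (auto simp: subedges_of_def)

lemma inj_subedge: "inj (\<lambda>m. (n, midpoint n m :: point))"
  by (rule injI) (simp add: midpoint_def)

lemma subedge_term:
  assumes "P \<noteq> Q"
  shows "subedge_length (P, midpoint P Q) *\<^sub>R ccw_normal P Q = (1/2) *\<^sub>R rot (Q - P)"
    "subedge_length (Q, midpoint Q P) *\<^sub>R ccw_normal P Q = (1/2) *\<^sub>R rot (Q - P)"
  using assms by (simp_all add: subedge_length_def ccw_normal_def dist_midpoint dist_commute)

text \<open>The half edge vectors before and after the node add up to half the vector joining its two
  neighbours.\<close>
lemma node_normal_eq:
  assumes nb: "{m. {n, m} \<in> cell_edges c} = {a, b}" "a \<noteq> b"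
    and ccw: "ccw_edge c a n" "ccw_edge c n b"
  shows "node_normal n c = (1/2) *\<^sub>R rot (b - a)"
proof -
  have ne: "a \<noteq> n" "n \<noteq> b" using ccw by (auto simp: ccw_edge_def)
  have "node_normal n c = (\<Sum>m\<in>{a, b}. subedge_length (n, midpoint n m) *\<^sub>R outward_normal (n, midpoint n m) c)"
    unfolding node_normal_def subedges_of_image nb(1)
    by (subst sum.reindex[OF inj_on_subset[OF inj_subedge subset_UNIV]]) simp
  also have "\<dots> = (1/2) *\<^sub>R rot (n - a) + (1/2) *\<^sub>R rot (b - n)"
    using nb(2) ne ccw by (simp add: ccw_edge_normal subedge_term)
  also have "\<dots> = (1/2) *\<^sub>R rot (b - a)"
    by (simp add: vec_eq_iff forall_2 field_simps)
  finally show ?thesis .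
qed

text \<open>The value is 1 if \<^term>\<open>m\<close> follows \<^term>\<open>n\<close> in the counterclockwise order around the cell, and -1 if it
  precedes \<^term>\<open>n\<close>. Defining it through the outward normal avoids choosing an orientation of the vertex list.\<close>
definition turn :: "point \<Rightarrow> point \<Rightarrow> cell \<Rightarrow> real" where
  "turn n m c = sgn (cross2 (outward_normal (n, midpoint n m) c) (m - n))"

lemma turn_ccw:
  assumes "ccw_edge c P Q"
  shows "turn P Q c = 1" "turn Q P c = -1"
proof -
  have "P \<noteq> Q" using assms by (simp add: ccw_edge_def)
  then have "0 < cross2 (ccw_normal P Q) (Q - P)"
    by (simp add: ccw_normal_def cross2_scaleR cross2_rot_self)
  moreover have "cross2 (ccw_normal P Q) (P - Q) = - cross2 (ccw_normal P Q) (Q - P)"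
    by (simp add: cross2_def algebra_simps)
  ultimately show "turn P Q c = 1" "turn Q P c = -1"
    by (simp_all add: turn_def ccw_edge_normal[OF assms])
qed

text \<open>The right-hand side is half the area times the difference of \<^term>\<open>q\<close> at the two neighbours of
  \<^term>\<open>n\<close>.\<close>
definition corner_identity :: "cell \<Rightarrow> point \<Rightarrow> bool" where
  "corner_identity c n \<longleftrightarrow> (\<forall>q. (\<Sum>m\<in>set c. q m * cross2 (node_normal n c) (node_normal m c)) =
     cell_area c / 2 * (\<Sum>m | {n, m} \<in> cell_edges c. turn n m c * q m))"

text \<open>Here all other vertices are neighbours of \<^term>\<open>A\<close>, and the node-normals are half the rotated
  opposite sides.\<close>
lemma triangle_corner_identity:
  assumes V: "set c = {A, B, C}" and E: "cell_edges c = {{A, B}, {B, C}, {C, A}}"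
    and area: "cell_area c = orient A B C / 2"
    and ccw: "ccw_edge c A B" "ccw_edge c B C" "ccw_edge c C A"
  shows "corner_identity c A"
proof -
  have ne: "A \<noteq> B" "B \<noteq> C" "C \<noteq> A" using ccw by (auto simp: ccw_edge_def)
  have nb: "{m. {A, m} \<in> cell_edges c} = {C, B}" "{m. {B, m} \<in> cell_edges c} = {A, C}"
    "{m. {C, m} \<in> cell_edges c} = {B, A}"
    using ne by (auto simp: E doubleton_eq_iff)
  have N: "node_normal A c = (1/2) *\<^sub>R rot (B - C)" "node_normal B c = (1/2) *\<^sub>R rot (C - A)"
    "node_normal C c = (1/2) *\<^sub>R rot (A - B)"
    using ne ccw by (auto intro!: node_normal_eq nb)
  show ?thesis unfolding corner_identity_def
  proof
    fix q :: "point \<Rightarrow> real"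
    have "(\<Sum>m\<in>set c. q m * cross2 (node_normal A c) (node_normal m c)) =
        q A * cross2 (node_normal A c) (node_normal A c) + q B * cross2 (node_normal A c) (node_normal B c)
        + q C * cross2 (node_normal A c) (node_normal C c)"
      using ne by (simp add: V)
    also have "\<dots> = orient A B C / 4 * (q B - q C)"
      by (simp add: N cross2_scaleR cross2_rot_rot) (simp add: cross2_def orient_alt field_simps)
    also have "\<dots> = cell_area c / 2 * (\<Sum>m | {A, m} \<in> cell_edges c. turn A m c * q m)"
      using ne by (simp add: nb area turn_ccw[OF ccw(1)] turn_ccw[OF ccw(3)])
    finally show "(\<Sum>m\<in>set c. q m * cross2 (node_normal A c) (node_normal m c)) =
      cell_area c / 2 * (\<Sum>m | {A, m} \<in> cell_edges c. turn A m c * q m)" .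
  qed
qed

text \<open>The node-normals at opposite vertices are antiparallel, so \<^term>\<open>C\<close> does not contribute; at
  \<^term>\<open>B\<close> and \<^term>\<open>D\<close> the product of the two diagonals appears, which is twice the area.\<close>
lemma quad_corner_identity:
  assumes V: "set c = {A, B, C, D}" and E: "cell_edges c = {{A, B}, {B, C}, {C, D}, {D, A}}"
    and dist: "distinct [A, B, C, D]"
    and area: "cell_area c = cross2 (C - A) (D - B) / 2"
    and ccw: "ccw_edge c A B" "ccw_edge c B C" "ccw_edge c C D" "ccw_edge c D A"
  shows "corner_identity c A"
proof -
  have "D \<noteq> B" using dist by auto
  have nb: "{m. {A, m} \<in> cell_edges c} = {D, B}" "{m. {B, m} \<in> cell_edges c} = {A, C}"
    "{m. {C, m} \<in> cell_edges c} = {B, D}" "{m. {D, m} \<in> cell_edges c} = {C, A}"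
    using dist by (auto simp: E doubleton_eq_iff)
  have N: "node_normal A c = (1/2) *\<^sub>R rot (B - D)" "node_normal B c = (1/2) *\<^sub>R rot (C - A)"
    "node_normal C c = (1/2) *\<^sub>R rot (D - B)" "node_normal D c = (1/2) *\<^sub>R rot (A - C)"
    using dist ccw by (auto intro!: node_normal_eq nb)
  show ?thesis unfolding corner_identity_def
  proof
    fix q :: "point \<Rightarrow> real"
    have "(\<Sum>m\<in>set c. q m * cross2 (node_normal A c) (node_normal m c)) =
        q A * cross2 (node_normal A c) (node_normal A c) + q B * cross2 (node_normal A c) (node_normal B c)
        + q C * cross2 (node_normal A c) (node_normal C c) + q D * cross2 (node_normal A c) (node_normal D c)"
      using dist by (simp add: V)
    also have "\<dots> = cross2 (C - A) (D - B) / 4 * (q B - q D)"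
      by (simp add: N cross2_scaleR cross2_rot_rot) (simp add: cross2_def field_simps)
    also have "\<dots> = cell_area c / 2 * (\<Sum>m | {A, m} \<in> cell_edges c. turn A m c * q m)"
      using \<open>D \<noteq> B\<close> by (simp add: nb area turn_ccw[OF ccw(1)] turn_ccw[OF ccw(4)])
    finally show "(\<Sum>m\<in>set c. q m * cross2 (node_normal A c) (node_normal m c)) =
      cell_area c / 2 * (\<Sum>m | {A, m} \<in> cell_edges c. turn A m c * q m)" .
  qed
qed

lemma small_cell:
  assumes "simple_polygon c" "card (cell_edges c) \<le> 4"
  shows small_cell_area: "0 < cell_area c"
    and small_cell_ccw: "\<And>P Q. {P, Q} \<in> cell_edges c \<Longrightarrow> ccw_edge c P Q \<or> ccw_edge c Q P"
    and small_cell_corner: "\<And>n. n \<in> set c \<Longrightarrow> corner_identity c n"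
proof -
  have "0 < cell_area c \<and> (\<forall>P Q. {P, Q} \<in> cell_edges c \<longrightarrow> ccw_edge c P Q \<or> ccw_edge c Q P) \<and>
    (\<forall>n\<in>set c. corner_identity c n)"
    using assms
  proof (cases rule: small_cell_cases)
    case (triangle A B C)
    note V = triangle(1) and E = triangle(2) and pos = triangle(3)
    have R: "cell_region c = convex hull {A, B, C}" by (rule triangle_cell_region[OF E pos])
    have area: "cell_area c = orient A B C / 2"
      by (simp add: cell_area_def R content_triangle_orient pos)
    have pos': "0 < orient B C A" "0 < orient C A B"
      using pos by (simp_all add: orient_rotate)
    have R': "cell_region c = convex hull {B, C, A}" "cell_region c = convex hull {C, A, B}"
      unfolding R by (simp_all add: insert_commute)
    have ccw: "ccw_edge c A B" "ccw_edge c B C" "ccw_edge c C A"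
      by (rule ccw_edgeI[of _ _ _ _ "{}", OF pos] ccw_edgeI[of _ _ _ _ "{}", OF pos'(1)]
          ccw_edgeI[of _ _ _ _ "{}", OF pos'(2)]; use R R' in auto)+
    have "corner_identity c A"
      by (rule triangle_corner_identity[OF V E area ccw])
    moreover have "corner_identity c B"
      by (rule triangle_corner_identity[of c B C A])
        (use V E area ccw in \<open>auto simp: orient_rotate\<close>)
    moreover have "corner_identity c C"
      by (rule triangle_corner_identity[of c C A B])
        (use V E area ccw in \<open>auto simp: orient_rotate\<close>)
    moreover have "ccw_edge c P Q \<or> ccw_edge c Q P" if "{P, Q} \<in> cell_edges c" for P Q
      using that ccw by (auto simp: E doubleton_eq_iff)
    ultimately show ?thesis using area pos V by auto
  next
    case (quad A B C D)
    note V = quad(1) and E = quad(2) and dist = quad(3) and pos = quad(4,5)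
    have R: "cell_region c = convex hull {A, B, C} \<union> convex hull {A, C, D}"
      by (rule quad_cell_region[OF E pos])
    have area: "cell_area c = cross2 (C - A) (D - B) / 2"
      by (simp add: cell_area_def R quad_area pos)
    have "cell_area c = (orient A B C + orient A C D) / 2"
      unfolding area by (simp add: cross2_def orient_alt algebra_simps)
    then have "0 < cell_area c" using pos by simp
    have E': "cell_edges c = {{C, D}, {D, A}, {A, B}, {B, C}}" unfolding E by auto
    have pos': "0 < orient C D A" "0 < orient C A B"
      using pos by (simp_all add: orient_rotate)
    note ccw = quad_ccw_edges[OF E pos] quad_ccw_edges[OF E' pos']
    have rots: "cross2 (D - B) (A - C) = cross2 (C - A) (D - B)" "cross2 (A - C) (B - D) = cross2 (C - A) (D - B)"
      "cross2 (B - D) (C - A) = cross2 (C - A) (D - B)"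
      by (simp_all add: cross2_def algebra_simps)
    have "corner_identity c A"
      by (rule quad_corner_identity[OF V E dist area ccw])
    moreover have "corner_identity c B"
      by (rule quad_corner_identity[of c B C D A]) (use V E dist area ccw rots in auto)
    moreover have "corner_identity c C"
      by (rule quad_corner_identity[of c C D A B]) (use V E dist area ccw rots in auto)
    moreover have "corner_identity c D"
      by (rule quad_corner_identity[of c D A B C]) (use V E dist area ccw rots in auto)
    moreover have "ccw_edge c P Q \<or> ccw_edge c Q P" if "{P, Q} \<in> cell_edges c" for P Q
      using that ccw by (auto simp: E doubleton_eq_iff)
    ultimately show ?thesis using \<open>0 < cell_area c\<close> V by auto
  qed
  then show "0 < cell_area c" "\<And>P Q. {P, Q} \<in> cell_edges c \<Longrightarrow> ccw_edge c P Q \<or> ccw_edge c Q P"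
    "\<And>n. n \<in> set c \<Longrightarrow> corner_identity c n"
    by auto
qed

section \<open>Cancellation around a node\<close>

text \<open>Both cells contain the points slightly to the left of the edge in their interiors.\<close>
lemma ccw_edge_not_shared:
  assumes "ccw_edge c P Q" "ccw_edge c' P Q"
  shows "interior (cell_region c) \<inter> interior (cell_region c') \<noteq> {}"
proof -
  have "P \<noteq> Q" using assms by (simp add: ccw_edge_def)
  then obtain x where "x \<in> open_segment P Q" by (metis ex_in_conv open_segment_eq_empty)
  then have "\<forall>\<^sub>F \<epsilon> in at_right 0. x - \<epsilon> *\<^sub>R ccw_normal P Q \<in> interior (cell_region c)"
    "\<forall>\<^sub>F \<epsilon> in at_right 0. x - \<epsilon> *\<^sub>R ccw_normal P Q \<in> interior (cell_region c')"
    using assms by (auto simp: ccw_edge_def)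
  then have "\<forall>\<^sub>F \<epsilon> in at_right (0::real). interior (cell_region c) \<inter> interior (cell_region c') \<noteq> {}"
    by eventually_elim auto
  then show ?thesis by simp
qed

lemma edge_subset: "e \<in> cell_edges c \<Longrightarrow> e \<subseteq> set c"
proof -
  have "c ! (Suc i mod length c) \<in> set c" if "i < length c" for i
    using that by (intro nth_mem mod_less_divisor) linarith
  then show "e \<in> cell_edges c \<Longrightarrow> e \<subseteq> set c" unfolding cell_edges_image by auto
qed

lemma vertex_in_region:
  assumes "n \<in> set c"
  shows "n \<in> cell_region c"
proof -
  obtain i where i: "i < length c" "n = c ! i" using assms by (auto simp: in_set_conv_nth)
  define e where "e = {c ! i, c ! (Suc i mod length c)}"
  have e: "e \<in> cell_edges c" "n \<in> e"
    unfolding cell_edges_image e_def using i by (blast, blast)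
  then have "n \<in> convex hull e" by (simp add: hull_inc)
  then have "n \<in> cell_boundary c" using e(1) by (auto simp: cell_boundary_def)
  then show ?thesis by (simp add: cell_region_def)
qed

lemma polygonal_gridD:
  assumes "polygonal_grid \<Lambda> C"
  shows "\<And>c. c \<in> C \<Longrightarrow> simple_polygon c"
    and "\<And>c c'. c \<in> C \<Longrightarrow> c' \<in> C \<Longrightarrow> c \<noteq> c' \<Longrightarrow> interior (cell_region c) \<inter> interior (cell_region c') = {}"
    and "\<And>x. \<exists>r>0. finite {c \<in> C. cell_region c \<inter> ball x r \<noteq> {}}"
    and "\<And>e. e \<in> grid_edges C \<Longrightarrow> card {c \<in> C. e \<in> cell_edges c} = 2"
  using assms[unfolded polygonal_grid_def] by (elim conjE; simp)+

lemma finite_cells_at: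
  assumes "polygonal_grid \<Lambda> C"
  shows "finite (cells_at C n)"
proof -
  obtain r where r: "r > 0" "finite {c \<in> C. cell_region c \<inter> ball n r \<noteq> {}}"
    using polygonal_gridD(3)[OF assms, of n] by auto
  have "n \<in> cell_region c \<inter> ball n r" if "n \<in> set c" for c
    using vertex_in_region[OF that] r(1) by simp
  then have "cells_at C n \<subseteq> {c \<in> C. cell_region c \<inter> ball n r \<noteq> {}}"
    unfolding cells_at_def by blast
  then show ?thesis using r(2) finite_subset by blast
qed

text \<open>The two cells at an edge do not overlap, hence lie on opposite sides of it and traverse it in
  opposite directions.\<close>
lemma turns_cancel:
  assumes grid: "polygonal_grid \<Lambda> C" and small: "\<And>c. c \<in> C \<Longrightarrow> card (cell_edges c) \<le> 4"
    and edge: "{n, m} \<in> grid_edges C"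
  shows "(\<Sum>c | c \<in> C \<and> {n, m} \<in> cell_edges c. turn n m c) = 0"
proof -
  have "card {c \<in> C. {n, m} \<in> cell_edges c} = 2"
    using polygonal_gridD(4)[OF grid edge] .
  then obtain c c' where cc: "{c \<in> C. {n, m} \<in> cell_edges c} = {c, c'}" "c \<noteq> c'"
    by (auto simp: card_2_iff)
  then have C: "c \<in> C" "c' \<in> C" "{n, m} \<in> cell_edges c" "{n, m} \<in> cell_edges c'" by auto
  then have sp: "simple_polygon c" "simple_polygon c'"
    and disj: "interior (cell_region c) \<inter> interior (cell_region c') = {}"
    using polygonal_gridD(1,2)[OF grid] cc(2) by auto
  have "ccw_edge c n m \<or> ccw_edge c m n" "ccw_edge c' n m \<or> ccw_edge c' m n"
    using small_cell_ccw sp small C by blast+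
  then consider "ccw_edge c n m" "ccw_edge c' m n" | "ccw_edge c m n" "ccw_edge c' n m"
    using ccw_edge_not_shared disj by blast
  then have "turn n m c + turn n m c' = 0"
    by cases (simp_all add: turn_ccw)
  then show ?thesis using cc by simp
qed

lemma finite_neighbours: "finite {m. {n, m} \<in> cell_edges c}"
  by (rule finite_subset[OF _ finite_set[of c]]) (use edge_subset in blast)

text \<open>Regrouping the sum by edges at \<^term>\<open>n\<close> makes it telescope around the node.\<close>
lemma corner_sums_cancel:
  assumes grid: "polygonal_grid \<Lambda> C" and small: "\<And>c. c \<in> C \<Longrightarrow> card (cell_edges c) \<le> 4"
  shows "(\<Sum>c\<in>cells_at C n. \<Sum>m | {n, m} \<in> cell_edges c. turn n m c * q m) = 0"
proof -
  define M where "M = (\<Union>c\<in>cells_at C n. {m. {n, m} \<in> cell_edges c})"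
  have fin: "finite (cells_at C n)" "finite M"
    using finite_cells_at[OF grid] finite_neighbours by (auto simp: M_def)
  have "(\<Sum>c\<in>cells_at C n. \<Sum>m | {n, m} \<in> cell_edges c. turn n m c * q m) =
        (\<Sum>c\<in>cells_at C n. \<Sum>m | m \<in> M \<and> {n, m} \<in> cell_edges c. turn n m c * q m)"
    by (intro sum.cong refl) (auto simp: M_def)
  also have "\<dots> = (\<Sum>m\<in>M. \<Sum>c | c \<in> cells_at C n \<and> {n, m} \<in> cell_edges c. turn n m c * q m)"
    using fin by (rule sum.swap_restrict)
  also have "\<dots> = (\<Sum>m\<in>M. (\<Sum>c | c \<in> C \<and> {n, m} \<in> cell_edges c. turn n m c) * q m)"
    unfolding sum_distrib_right using edge_subset by (intro sum.cong refl) (auto simp: cells_at_def)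
  also have "\<dots> = 0"
  proof (intro sum.neutral ballI)
    fix m assume "m \<in> M"
    then have "{n, m} \<in> grid_edges C" by (auto simp: M_def cells_at_def grid_edges_def)
    then show "(\<Sum>c | c \<in> C \<and> {n, m} \<in> cell_edges c. turn n m c) * q m = 0"
      using turns_cancel[OF grid small] by simp
  qed
  finally show ?thesis .
qed

text \<open>The discrete counterpart of curl grad = 0. The area produced by the cross products cancels the factor of the gradient in each cell.\<close>
lemma pressure_force_irrotational:
  assumes grid: "polygonal_grid \<Lambda> C" and small: "\<And>c. c \<in> C \<Longrightarrow> card (cell_edges c) \<le> 4"
  shows "(\<Sum>c\<in>cells_at C n. cross2 (node_normal n c)
           (- (1 / cell_area c) *\<^sub>R (\<Sum>m\<in>set c. q m *\<^sub>R node_normal m c))) = 0"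
proof -
  have "cross2 (node_normal n c) (- (1 / cell_area c) *\<^sub>R (\<Sum>m\<in>set c. q m *\<^sub>R node_normal m c)) =
      - (1/2) * (\<Sum>m | {n, m} \<in> cell_edges c. turn n m c * q m)" if c: "c \<in> cells_at C n" for c
  proof -
    have "simple_polygon c" "card (cell_edges c) \<le> 4" "n \<in> set c"
      using polygonal_gridD(1)[OF grid] small c by (auto simp: cells_at_def)
    note cell = small_cell_area[OF this(1,2)] small_cell_corner[OF this]
    have "cross2 (node_normal n c) (- (1 / cell_area c) *\<^sub>R (\<Sum>m\<in>set c. q m *\<^sub>R node_normal m c)) =
        - (1 / cell_area c) * (\<Sum>m\<in>set c. q m * cross2 (node_normal n c) (node_normal m c))"
      by (simp add: cross2_scaleR cross2_minus cross2_sum_right)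
    then show ?thesis using cell by (simp add: corner_identity_def)
  qed
  then have "(\<Sum>c\<in>cells_at C n. cross2 (node_normal n c)
           (- (1 / cell_area c) *\<^sub>R (\<Sum>m\<in>set c. q m *\<^sub>R node_normal m c))) =
      - (1/2) * (\<Sum>c\<in>cells_at C n. \<Sum>m | {n, m} \<in> cell_edges c. turn n m c * q m)"
    by (simp add: sum_distrib_left)
  then show ?thesis using corner_sums_cancel[OF grid small] by simp
qed

theorem mainTheorem2:
  fixes \<Lambda> :: "point set" and C :: "cell set" and \<nu> :: "subedge \<Rightarrow> point"
    and T :: "real set" and v :: "real \<Rightarrow> cell \<Rightarrow> point" and p :: "real \<Rightarrow> cell \<Rightarrow> real"
  assumes "polygonal_grid \<Lambda> C"
    and "\<And>c. c \<in> C \<Longrightarrow> card (cell_edges c) \<le> 4"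
    and "\<And>n. n \<in> grid_nodes C \<Longrightarrow> 0 < dual_area C n"
    and "\<And>n s. n \<in> grid_nodes C \<Longrightarrow> s \<in> subedges_at C n \<Longrightarrow> unit_normal s (\<nu> s)"
    and "is_interval T"
    and "nodal_pressure_solution \<Lambda> C \<nu> T v p"
  shows "\<forall>n\<in>grid_nodes C. \<forall>t\<in>T.
           ((\<lambda>\<tau>. discrete_vorticity C (v \<tau>) n) has_real_derivative 0) (at t within T)"
proof (intro ballI)
  fix n t assume "n \<in> grid_nodes C" and t: "t \<in> T"
  define q where "q = nodal_pressure C \<nu> (v t) (p t)"
  have "((\<lambda>\<tau>. cross2 (node_normal n c) (v \<tau> c)) has_vector_derivative
      cross2 (node_normal n c) (- (1 / cell_area c) *\<^sub>R (\<Sum>m\<in>set c. q m *\<^sub>R node_normal m c))) (at t within T)"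
    if "c \<in> cells_at C n" for c
  proof (rule bounded_linear.has_vector_derivative[OF bounded_linear_cross2])
    show "((\<lambda>\<tau>. v \<tau> c) has_vector_derivative
      - (1 / cell_area c) *\<^sub>R (\<Sum>m\<in>set c. q m *\<^sub>R node_normal m c)) (at t within T)"
      using assms(6)[unfolded nodal_pressure_solution_def, THEN conjunct2] t that
      unfolding q_def cells_at_def by blast
  qed
  then have "((\<lambda>\<tau>. \<Sum>c\<in>cells_at C n. cross2 (node_normal n c) (v \<tau> c)) has_vector_derivative
      (\<Sum>c\<in>cells_at C n. cross2 (node_normal n c)
         (- (1 / cell_area c) *\<^sub>R (\<Sum>m\<in>set c. q m *\<^sub>R node_normal m c)))) (at t within T)"
    by (rule has_vector_derivative_sum)
  then have "((\<lambda>\<tau>. \<Sum>c\<in>cells_at C n. cross2 (node_normal n c) (v \<tau> c)) has_vector_derivative 0) (at t within T)"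
    by (rule has_vector_derivative_eq_rhs) (rule pressure_force_irrotational[OF assms(1,2)])
  then have "((\<lambda>\<tau>. \<Sum>c\<in>cells_at C n. cross2 (node_normal n c) (v \<tau> c)) has_real_derivative 0) (at t within T)"
    by (simp add: has_real_derivative_iff_has_vector_derivative)
  from DERIV_cmult[OF this, of "- (1 / dual_area C n)"]
  show "((\<lambda>\<tau>. discrete_vorticity C (v \<tau>) n) has_real_derivative 0) (at t within T)"
    unfolding discrete_vorticity_def by (simp only: mult_zero_right)
qed

end
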